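(* Let $g$ be an exterior escape metric on $\mathbb{R}^n$ with associated constant $r_c>0$. Then, for any $x$ with $|x|\ge r_c$ and any unit-speed geodesic $\gamma(t)$ of $(\mathbb{R}^n,g)$ starting at $x$, the following hold: (1) If $|x|=r_c$ and $\left\langle\gamma'(0),\frac{\partial}{\partial r}\right\rangle_g\ge 0$, then $\lim_{t\to+\infty}|\gamma(t)|=+\infty$. (2) If $|x|>r_c$, then either $\lim_{t\to+\infty}|\gamma(t)|=+\infty$, or there exist positive constants $c(x)$ and $t_0=t_0(x,\gamma'(0))$ such that $$ 0<t_0\le c(x)\quad\text{and}\quad |\gamma(t_0)|=r_c. $$
   Context: Setting. Let $n\ge 2$, $r=r(x)=|x|$ the Euclidean norm, $\langle\cdot,\cdot\rangle$ the standard inner product, $\partial/\partial r=x/|x|$ for $x\neq 0$; for a matrix-valued function $G$, $\partial G/\partial r$ is the entrywise radial derivative in Cartesian coordinates. $(\mathbb{R}^n,g)$ is a smooth complete Riemannian manifold, $g=\sum g_{ij}(x)dx_idx_j$, $G(x)=(g_{ij}(x))$, and there is a constant $r_c>0$ with $G(x)\frac{\partial}{\partial r}=\frac{\partial}{\partial r}$ for $|x|\ge r_c$. Write $\langle X,Y\rangle_g=\langle G(x)X,Y\rangle$, $|X|_g^2=\langle X,X\rangle_g$. $S(r)$ is the Euclidean sphere of radius $r$ centred at the origin and $S(r)_x$ its tangent space at $x$ (with $|x|=r$). Definition. $g$ is an exterior escape metric if $$\left\langle \left(\tfrac12\tfrac{\partial G(x)}{\partial r}\right)X,X\right\rangle\ge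 \alpha(x)|X|_g^2\quad\text{for } X\in S(r)_x,\ |x|\ge r_c,$$ where $\alpha$ is a smooth function on $|x|\ge r_c$ satisfying $\alpha(x)>-\frac1r$ for $|x|\ge r_c$. The notation $c(x)$ denotes a constant depending on $x$ (and not on the direction of the geodesic), while $t_0(x,\gamma'(0))$ may depend on both $x$ and $\gamma'(0)$. *)

theory Defs
  imports "HOL-Analysis.Analysis"
begin

text \<open>\<open>C\<^sup>k\<close> on an open set.\<close>

primrec Ck_on :: "nat \<Rightarrow> 'a::euclidean_space set \<Rightarrow> ('a \<Rightarrow> 'b::real_normed_vector) \<Rightarrow> bool" where
  "Ck_on 0 U f \<longleftrightarrow> continuous_on U f"
| "Ck_on (Suc k) U f \<longleftrightarrow>
     (\<forall>x\<in>U. f differentiable (at x)) \<and> (\<forall>v. Ck_on k U (\<lambda>x. frechet_derivative f (at x) v))"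

text \<open>On a set that is not open, smoothness means having a smooth extension to an open
  neighbourhood.\<close>

definition smooth_on :: "'a::euclidean_space set \<Rightarrow> ('a \<Rightarrow> 'b::real_normed_vector) \<Rightarrow> bool" where
  "smooth_on S f \<longleftrightarrow>
     (\<exists>U h. open U \<and> S \<subseteq> U \<and> (\<forall>k. Ck_on k U h) \<and> (\<forall>x\<in>S. h x = f x))"

definition riemannian_metric :: "(real^'n \<Rightarrow> real^'n^'n) \<Rightarrow> bool" where
  "riemannian_metric G \<longleftrightarrow>
     smooth_on UNIV G \<and>
     (\<forall>x. transpose (G x) = G x) \<and>
     (\<forall>x v. v \<noteq> 0 \<longrightarrow> (G x *v v) \<bullet> v > 0)"

definition g_inner :: "(real^'n \<Rightarrow> real^'n^'n) \<Rightarrow> real^'n \<Rightarrow> real^'n \<Rightarrow> real^'n \<Rightarrow> real" where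
  "g_inner G x X Y = (G x *v X) \<bullet> Y"

definition g_norm :: "(real^'n \<Rightarrow> real^'n^'n) \<Rightarrow> real^'n \<Rightarrow> real^'n \<Rightarrow> real" where
  "g_norm G x X = sqrt (g_inner G x X X)"

definition partial_deriv :: "'n::finite \<Rightarrow> (real^'n \<Rightarrow> real) \<Rightarrow> real^'n \<Rightarrow> real" where
  "partial_deriv i f x = frechet_derivative f (at x) (axis i 1)"

definition christoffel ::
    "(real^'n \<Rightarrow> real^'n^'n) \<Rightarrow> real^'n \<Rightarrow> 'n \<Rightarrow> 'n \<Rightarrow> 'n \<Rightarrow> real" where
  "christoffel G x k i j =
     (1/2) * (\<Sum>l\<in>UNIV. matrix_inv (G x) $ k $ l *
        (partial_deriv i (\<lambda>y. G y $ j $ l) x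
         + partial_deriv j (\<lambda>y. G y $ i $ l) x
         - partial_deriv l (\<lambda>y. G y $ i $ j) x))"

text \<open>Derivatives are taken within the interval \<open>I\<close>, hence one-sided at an endpoint belonging
  to it.\<close>

definition velocity :: "real set \<Rightarrow> (real \<Rightarrow> real^'n) \<Rightarrow> real \<Rightarrow> real^'n" where
  "velocity I \<gamma> t = vector_derivative \<gamma> (at t within I)"

definition geodesic_on :: "(real^'n \<Rightarrow> real^'n^'n) \<Rightarrow> real set \<Rightarrow> (real \<Rightarrow> real^'n) \<Rightarrow> bool" where
  "geodesic_on G I \<gamma> \<longleftrightarrow>
     (\<forall>t\<in>I. (\<gamma> has_vector_derivative velocity I \<gamma> t) (at t within I) \<and>
        (velocity I \<gamma> has_vector_derivative
          (\<chi> k. - (\<Sum>i\<in>UNIV. \<Sum>j\<in>UNIV.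
             christoffel G (\<gamma> t) k i j * velocity I \<gamma> t $ i * velocity I \<gamma> t $ j)))
          (at t within I))"

text \<open>Completeness in the geodesic sense.\<close>

definition complete_riemannian_metric :: "(real^'n \<Rightarrow> real^'n^'n) \<Rightarrow> bool" where
  "complete_riemannian_metric G \<longleftrightarrow>
     riemannian_metric G \<and>
     (\<forall>p v. \<exists>\<gamma>. geodesic_on G UNIV \<gamma> \<and> \<gamma> 0 = p \<and> velocity UNIV \<gamma> 0 = v)"

definition unit_speed_geodesic_from ::
    "(real^'n \<Rightarrow> real^'n^'n) \<Rightarrow> real^'n \<Rightarrow> (real \<Rightarrow> real^'n) \<Rightarrow> bool" where
  "unit_speed_geodesic_from G x \<gamma> \<longleftrightarrow>
     geodesic_on G {0..} \<gamma> \<and> \<gamma> 0 = x \<and>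
     (\<forall>t\<ge>0. g_norm G (\<gamma> t) (velocity {0..} \<gamma> t) = 1)"

definition radial_vector :: "real^'n \<Rightarrow> real^'n" where
  "radial_vector x = x /\<^sub>R norm x"

definition radial_matrix_deriv :: "(real^'n \<Rightarrow> real^'n^'n) \<Rightarrow> real^'n \<Rightarrow> real^'n^'n" where
  "radial_matrix_deriv G x =
     (\<chi> i j. deriv (\<lambda>s. G (s *\<^sub>R radial_vector x) $ i $ j) (norm x))"

text \<open>The tangent space at \<open>x\<close> of the Euclidean sphere of radius \<open>norm x\<close> about the origin.\<close>

definition sphere_tangent :: "real^'n \<Rightarrow> (real^'n) set" where
  "sphere_tangent x = {X. X \<bullet> x = 0}"

definition exterior_escape_metric :: "(real^'n \<Rightarrow> real^'n^'n) \<Rightarrow> real \<Rightarrow> bool" where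
  "exterior_escape_metric G r\<^sub>c \<longleftrightarrow>
     complete_riemannian_metric G \<and> r\<^sub>c > 0 \<and>
     (\<forall>x. norm x \<ge> r\<^sub>c \<longrightarrow> G x *v radial_vector x = radial_vector x) \<and>
     (\<exists>\<alpha> :: real^'n \<Rightarrow> real.
        smooth_on {x. norm x \<ge> r\<^sub>c} \<alpha> \<and>
        (\<forall>x. norm x \<ge> r\<^sub>c \<longrightarrow> \<alpha> x > - 1 / norm x) \<and>
        (\<forall>x X. norm x \<ge> r\<^sub>c \<and> X \<in> sphere_tangent x \<longrightarrow>
           (((1/2) *\<^sub>R radial_matrix_deriv G x) *v X) \<bullet> X \<ge> \<alpha> x * (g_norm G x X)\<^sup>2))"

end

theory Submission
  imports Defs
begin

text \<open>
  Along a unit-speed geodesic \<open>\<gamma>\<close> put \<open>h = |\<gamma>|\<^sup>2 / 2\<close>.  Because \<open>G\<close> fixes the radial direction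
  outside the ball of radius \<open>r\<^sub>c\<close>, the geodesic equation yields
  \<open>h'' = |\<gamma>'|\<^sub>g\<^sup>2 + (1/2) \<langle>DG(\<gamma>)[\<gamma>] \<gamma>', \<gamma>'\<rangle>\<close> whenever \<open>|\<gamma>| \<ge> r\<^sub>c\<close>, boundary sphere
  included (\<open>exterior_radial_acceleration\<close>).  The symmetric matrix \<open>DG(x)[x] = r \<partial>G/\<partial>r\<close>
  annihilates \<open>x\<close>, so only the component of \<open>\<gamma>'\<close> tangent to the sphere enters the last term,
  and there the escape inequality applies: \<open>h'' \<ge> min 1 (1 + r \<alpha>) > 0\<close>
  (\<open>escape_condition_convexity\<close>).  By compactness this lower bound is uniform on every annulus
  \<open>r\<^sub>c \<le> |x| \<le> R\<close> (\<open>annulus_radial_convexity\<close>).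

  What remains concerns a real function with this convexity property.  If \<open>|\<gamma>| \<ge> r\<^sub>c\<close> and
  \<open>h' \<ge> 0\<close> at some time, then \<open>h'\<close> is positive ever after, so \<open>h\<close> increases; it cannot stay
  bounded, because then \<open>h''\<close> would be bounded away from zero
  (\<open>convex_above_level_escapes\<close>).  If \<open>|x| > r\<^sub>c\<close> and \<open>h'(0) < 0\<close>, then as long as \<open>\<gamma>\<close> moves
  inwards without meeting the sphere of radius \<open>r\<^sub>c\<close> it stays in the annulus
  \<open>r\<^sub>c \<le> |y| \<le> |x|\<close>, where \<open>h'' \<ge> \<delta>\<close> for some \<open>\<delta> > 0\<close> depending on \<open>x\<close> alone.  Since
  \<open>h'(0) \<ge> - |x|\<close>, by the time \<open>|x| / \<delta>\<close> either the sphere has been met or \<open>h'\<close> has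
  become nonnegative (\<open>convex_above_level_turns\<close>), and in the second case \<open>\<gamma>\<close> escapes.
\<close>

section \<open>Functions that are convex above a level\<close>

lemma deriv_pos_imp_strict_increase:
  fixes f f' :: "real \<Rightarrow> real"
  assumes der: "\<And>t. t \<ge> 0 \<Longrightarrow> (f has_real_derivative f' t) (at t within {0..})"
    and "0 \<le> a" "a < b" and pos: "\<And>t. a < t \<Longrightarrow> t < b \<Longrightarrow> f' t > 0"
  shows "f a < f b"
proof -
  have "continuous_on {a..b} f"
  proof (rule continuous_on_subset)
    show "continuous_on {0..} f"
      using der by (auto intro: DERIV_continuous_on)
    show "{a..b} \<subseteq> {0..}" using assms(2) by auto
  qed
  moreover have "(f has_real_derivative f' t) (at t)" if "a < t" "t < b" for t
    using der[of t] that \<open>0 \<le> a\<close> at_within_interior[of t "{0..}"] by simp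
  ultimately show ?thesis
    using DERIV_pos_imp_increasing_open[of a b f] \<open>a < b\<close> pos by blast
qed

lemma deriv_ge_imp_growth:
  fixes f f' :: "real \<Rightarrow> real"
  assumes der: "\<And>t. t \<ge> 0 \<Longrightarrow> (f has_real_derivative f' t) (at t within {0..})"
    and "0 \<le> a" "a \<le> b" and ge: "\<And>t. a \<le> t \<Longrightarrow> t \<le> b \<Longrightarrow> f' t \<ge> d"
  shows "f b \<ge> f a + d * (b - a)"
proof -
  have "(f has_real_derivative f' t) (at t within {a..b})" if "a \<le> t" "t \<le> b" for t
    using der[of t] that \<open>0 \<le> a\<close> by (auto intro: DERIV_subset)
  hence "((\<lambda>t. f t - d * t) has_real_derivative f' t - d) (at t within {a..b})"
    if "a \<le> t" "t \<le> b" for t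
    using that by (auto intro!: derivative_eq_intros)
  hence "\<And>t. t \<in> {a..b} \<Longrightarrow> ((\<lambda>t. f t - d * t) has_vector_derivative f' t - d) (at t within {a..b})"
    by (auto simp: has_real_derivative_iff_has_vector_derivative)
  hence "((\<lambda>t. f' t - d) has_integral (f b - d * b) - (f a - d * a)) {a..b}"
    using \<open>a \<le> b\<close> by (intro fundamental_theorem_of_calculus) auto
  hence "(f b - d * b) - (f a - d * a) \<ge> 0"
    by (rule has_integral_nonneg) (use ge in auto)
  thus ?thesis by (simp add: algebra_simps)
qed

text \<open>Since \<open>h''(T) > 0\<close>, the slope is positive just after \<open>T\<close> even if \<open>h'(T) = 0\<close>.  Up to a
  first later time with \<open>h' \<le> 0\<close> the function would increase, hence stay above the level \<open>a\<close>,
  so \<open>h'\<close> would have been increasing from its nonnegative value at \<open>T\<close>: a contradiction.\<close>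

lemma convex_above_level_stays_increasing:
  fixes h h' h'' :: "real \<Rightarrow> real"
  assumes d1: "\<And>t. t \<ge> 0 \<Longrightarrow> (h has_real_derivative h' t) (at t within {0..})"
    and d2: "\<And>t. t \<ge> 0 \<Longrightarrow> (h' has_real_derivative h'' t) (at t within {0..})"
    and pos: "\<And>t. t \<ge> 0 \<Longrightarrow> a \<le> h t \<Longrightarrow> h'' t > 0"
    and T: "T \<ge> 0" "a \<le> h T" "h' T \<ge> 0" and "t > T"
  shows "h' t > 0"
proof (rule ccontr)
  assume neg: "\<not> h' t > 0"
  have "h'' T > 0" using pos T by auto
  have "(h' has_real_derivative h'' T) (at T within {T..})"
    using d2[of T] T by (auto intro: DERIV_subset)
  then obtain e where e: "e > 0" "\<And>s. s > 0 \<Longrightarrow> T + s \<in> {T..} \<Longrightarrow> s < e \<Longrightarrow> h' T < h' (T + s)"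
    using has_real_derivative_pos_inc_right[of h' "h'' T" T "{T..}"] \<open>h'' T > 0\<close> by blast
  define m where "m = min (T + e/2) t"
  have init: "h' s > 0" if "T < s" "s < T + e" for s
    using e(2)[of "s - T"] that T by auto
  have m: "T < m" "m \<le> t" "\<And>s. T < s \<Longrightarrow> s \<le> m \<Longrightarrow> h' s > 0"
    using e \<open>t > T\<close> by (auto simp: m_def intro!: init)
  \<comment> \<open>\<open>m\<close> lies in the initial stretch where \<open>h'\<close> is positive, so \<open>S = Inf Z\<close> is the first time
    after \<open>T\<close> at which positivity fails.\<close>
  define Z where "Z = {s \<in> {m..t}. h' s \<le> 0}"
  have cont: "continuous_on {m..t} h'"
  proof (rule continuous_on_subset)
    show "continuous_on {0..} h'" using d2 by (auto intro: DERIV_continuous_on)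
    show "{m..t} \<subseteq> {0..}" using T m by auto
  qed
  have "closed Z"
    unfolding Z_def by (intro continuous_closed_preimage_constant continuous_on_closed_Collect_le cont) auto
  moreover have "t \<in> Z" using neg m by (auto simp: Z_def)
  moreover have "bdd_below Z" by (rule bdd_belowI[of _ m]) (auto simp: Z_def)
  ultimately have "Inf Z \<in> Z" using closed_contains_Inf[of Z] by auto
  define S where "S = Inf Z"
  have S: "m \<le> S" "S \<le> t" "h' S \<le> 0" using \<open>Inf Z \<in> Z\<close> by (auto simp: S_def Z_def)
  have before: "h' s > 0" if "T < s" "s < S" for s
  proof (cases "s \<le> m")
    case False
    show ?thesis
    proof (rule ccontr)
      assume "\<not> ?thesis"
      hence "s \<in> Z" using False that S by (auto simp: Z_def)
      hence "S \<le> s" unfolding S_def by (intro cInf_lower \<open>bdd_below Z\<close>)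
      thus False using that by simp
    qed
  qed (use that m in auto)
  have "h T < h s" if "T < s" "s < S" for s
    by (rule deriv_pos_imp_strict_increase[OF d1]) (use that T before in auto)
  hence "h'' s > 0" if "T < s" "s < S" for s
    using pos[of s] that T by force
  hence "h' T < h' S"
    by (intro deriv_pos_imp_strict_increase[OF d2]) (use T m S in auto)
  thus False using S T by simp
qed

text \<open>After time \<open>T\<close> the function increases.  A bound \<open>R\<close> would confine it to the band
  \<open>[a, R]\<close>, where \<open>h''\<close> has a positive lower bound \<open>\<delta>\<close>; then \<open>h'\<close> is eventually at
  least \<open>\<delta>\<close> and \<open>h\<close> grows linearly, contradicting the bound.\<close>

lemma convex_above_level_escapes:
  fixes h h' h'' :: "real \<Rightarrow> real"
  assumes d1: "\<And>t. t \<ge> 0 \<Longrightarrow> (h has_real_derivative h' t) (at t within {0..})"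
    and d2: "\<And>t. t \<ge> 0 \<Longrightarrow> (h' has_real_derivative h'' t) (at t within {0..})"
    and convex: "\<And>R. \<exists>\<delta>>0. \<forall>t\<ge>0. a \<le> h t \<and> h t \<le> R \<longrightarrow> h'' t \<ge> \<delta>"
    and T: "T \<ge> 0" "a \<le> h T" "h' T \<ge> 0"
  shows "filterlim h at_top at_top"
proof -
  have pos: "h'' t > 0" if t: "t \<ge> 0" "a \<le> h t" for t
    using convex[of "h t"] t by fastforce
  have inc: "h' t > 0" if "t > T" for t
    using convex_above_level_stays_increasing[OF d1 d2 pos T that] by blast
  have mono: "h s \<le> h t" if "T \<le> s" "s \<le> t" for s t
  proof (cases "s = t")
    case False
    thus ?thesis using deriv_pos_imp_strict_increase[OF d1, of s t] that T inc by fastforce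
  qed auto
  have unbounded: "\<exists>t\<ge>T. h t > R" for R
  proof (rule ccontr)
    assume "\<not> ?thesis"
    hence le: "\<And>t. t \<ge> T \<Longrightarrow> h t \<le> R" by force
    obtain \<delta> where \<delta>: "\<delta> > 0" "\<And>t. t \<ge> 0 \<Longrightarrow> a \<le> h t \<Longrightarrow> h t \<le> R \<Longrightarrow> h'' t \<ge> \<delta>"
      using convex[of R] by blast
    have h'': "h'' t \<ge> \<delta>" if "t \<ge> T" for t
      using \<delta>(2)[of t] le[of t] mono[of T t] that T by linarith
    have h': "h' t \<ge> \<delta>" if "t \<ge> T + 1" for t
    proof -
      have "h' t \<ge> h' T + \<delta> * (t - T)"
        by (rule deriv_ge_imp_growth[OF d2]) (use that T h'' in auto)
      moreover have "\<delta> * (t - T) \<ge> \<delta> * 1" using that \<delta> by (intro mult_left_mono) auto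
      ultimately show ?thesis using T by linarith
    qed
    define t where "t = T + 1 + (\<bar>R - h (T + 1)\<bar> + 1) / \<delta>"
    have t: "t \<ge> T + 1" using \<delta> by (simp add: t_def)
    have "h t \<ge> h (T + 1) + \<delta> * (t - (T + 1))"
      by (rule deriv_ge_imp_growth[OF d1]) (use t T h' in auto)
    also have "\<delta> * (t - (T + 1)) = \<bar>R - h (T + 1)\<bar> + 1" using \<delta> by (simp add: t_def)
    finally show False using le[of t] t by linarith
  qed
  show ?thesis
    unfolding filterlim_at_top
  proof
    fix R
    obtain s where "s \<ge> T" "h s > R" using unbounded by blast
    hence "R \<le> h t" if "t \<ge> s" for t using mono[of s t] that by linarith
    thus "eventually (\<lambda>t. R \<le> h t) at_top" unfolding eventually_at_top_linorder by blast
  qed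
qed

text \<open>While \<open>h' < 0\<close> the values of \<open>h\<close> lie in the band \<open>[a, h 0]\<close>, on which
  \<open>h'' \<ge> \<delta>\<close>; the slope \<open>- M\<close> is used up after the time \<open>M / \<delta>\<close>.\<close>

lemma convex_above_level_turns:
  fixes h h' h'' :: "real \<Rightarrow> real"
  assumes d1: "\<And>t. t \<ge> 0 \<Longrightarrow> (h has_real_derivative h' t) (at t within {0..})"
    and d2: "\<And>t. t \<ge> 0 \<Longrightarrow> (h' has_real_derivative h'' t) (at t within {0..})"
    and convex: "\<And>t. t \<ge> 0 \<Longrightarrow> a \<le> h t \<Longrightarrow> h t \<le> h 0 \<Longrightarrow> h'' t \<ge> \<delta>"
    and "\<delta> > 0" "M \<ge> 0" "h' 0 \<ge> - M"
    and above: "\<And>t. 0 \<le> t \<Longrightarrow> t \<le> M / \<delta> \<Longrightarrow> a \<le> h t"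
  shows "\<exists>T. 0 \<le> T \<and> T \<le> M / \<delta> \<and> h' T \<ge> 0"
proof (rule ccontr)
  assume "\<not> ?thesis"
  hence neg: "\<And>t. 0 \<le> t \<Longrightarrow> t \<le> M / \<delta> \<Longrightarrow> h' t < 0" by force
  have d1': "((\<lambda>t. - h t) has_real_derivative - h' t) (at t within {0..})" if "t \<ge> 0" for t
    using d1[OF that] by (rule DERIV_minus)
  have "h t \<le> h 0" if "0 \<le> t" "t \<le> M / \<delta>" for t
    using deriv_ge_imp_growth[OF d1', of 0 t 0] that neg by fastforce
  hence "h' (M / \<delta>) \<ge> h' 0 + \<delta> * (M / \<delta> - 0)"
    by (intro deriv_ge_imp_growth[OF d2]) (use assms in auto)
  thus False using neg[of "M / \<delta>"] \<open>\<delta> > 0\<close> \<open>M \<ge> 0\<close> \<open>h' 0 \<ge> - M\<close> by simp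
qed

section \<open>The geodesic equation\<close>

lemma riemannian_metric_invertible:
  assumes "riemannian_metric G"
  shows "invertible (G x)"
proof -
  have "v = 0" if "G x *v v = 0" for v
    using assms that unfolding riemannian_metric_def by (metis inner_zero_left less_irrefl)
  thus ?thesis
    by (metis invertible_left_inverse matrix_left_invertible_ker)
qed

lemma riemannian_metric_has_derivative:
  assumes "riemannian_metric G"
  shows "(G has_derivative frechet_derivative G (at x)) (at x)"
proof -
  obtain U h where U: "(UNIV :: (real^'a) set) \<subseteq> U" "\<forall>k. Ck_on k U h" "\<forall>x\<in>UNIV. h x = G x"
    using assms unfolding riemannian_metric_def smooth_on_def by blast
  hence "h = G" by auto
  moreover have "Ck_on (Suc 0) U h" using U by blast
  ultimately have "G differentiable (at x)" using U by auto
  thus ?thesis by (simp add: frechet_derivative_works)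
qed

lemma partial_deriv_entry:
  fixes G :: "real^'n \<Rightarrow> real^'n^'n"
  assumes "(G has_derivative D) (at x)"
  shows "partial_deriv i (\<lambda>y. G y $ j $ l) x = D (axis i 1) $ j $ l"
proof -
  have "((\<lambda>y. G y $ j $ l) has_derivative (\<lambda>v. D v $ j $ l)) (at x)"
    using assms by (intro bounded_linear.has_derivative[OF bounded_linear_vec_nth])
  thus ?thesis
    unfolding partial_deriv_def by (metis frechet_derivative_at)
qed

lemma bilinear_matrix_expand:
  fixes A :: "real^'n^'n"
  shows "(A *v v) \<bullet> w = (\<Sum>i\<in>UNIV. \<Sum>j\<in>UNIV. A $ i $ j * v $ j * w $ i)"
  by (simp add: matrix_vector_mult_def inner_vec_def sum_distrib_left sum_distrib_right mult_ac)

lemma linear_sum_axis: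
  fixes D :: "real^'n \<Rightarrow> real^'n^'n"
  assumes "linear D"
  shows "D v $ j $ l = (\<Sum>i\<in>UNIV. v $ i * D (axis i 1) $ j $ l)"
proof -
  have "D v = D (\<Sum>i\<in>UNIV. v $ i *\<^sub>R axis i 1)"
    by (simp add: basis_expansion flip: scalar_mult_eq_scaleR)
  also have "\<dots> = (\<Sum>i\<in>UNIV. v $ i *\<^sub>R D (axis i 1))"
    using assms by (simp add: linear_sum linear_scale)
  finally show ?thesis by simp
qed

lemma symmetric_matrix_inner:
  fixes A :: "real^'n^'n"
  assumes "transpose A = A"
  shows "(A *v v) \<bullet> w = v \<bullet> (A *v w)"
  using assms by (metis dot_lmul_matrix transpose_matrix_vector)

lemma metric_derivative_symmetric:
  fixes G :: "real^'n \<Rightarrow> real^'n^'n"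
  assumes G: "riemannian_metric G" and D: "(G has_derivative D) (at x)"
  shows "transpose (D v) = D v"
proof -
  have "transpose (G z) = G z" for z using G by (simp add: riemannian_metric_def)
  hence sym: "G z $ i $ j = G z $ j $ i" for z i j by (metis transpose_def vec_lambda_beta)
  have entry: "((\<lambda>y. G y $ i $ j) has_derivative (\<lambda>v. D v $ i $ j)) (at x)" for i j
    using D by (intro bounded_linear.has_derivative[OF bounded_linear_vec_nth])
  have "(\<lambda>v. D v $ i $ j) = (\<lambda>v. D v $ j $ i)" for i j
    by (rule has_derivative_unique[OF entry]) (use entry[of j i] in \<open>simp add: sym\<close>)
  thus ?thesis by (simp add: transpose_def vec_eq_iff fun_eq_iff)
qed

text \<open>Lowering the index of the Christoffel symbols turns the geodesic equation into the
  Euler-Lagrange equation of the kinetic energy; the hypothesis on \<open>w\<close> is the geodesic equation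
  for the acceleration.\<close>

lemma christoffel_lowered:
  fixes G :: "real^'n \<Rightarrow> real^'n^'n"
  assumes G: "riemannian_metric G" and D: "(G has_derivative D) (at x)"
    and w: "w = (\<chi> k. - (\<Sum>i\<in>UNIV. \<Sum>j\<in>UNIV. christoffel G x k i j * v $ i * v $ j))"
  shows "(G x *v w) \<bullet> y = (1/2) * ((D y *v v) \<bullet> v) - (D v *v v) \<bullet> y"
proof -
  define B where "B = (\<lambda>i j l. D (axis i 1) $ j $ l + D (axis j 1) $ i $ l - D (axis l 1) $ i $ j)"
  define b where "b = (\<chi> l. (1/2) * (\<Sum>i\<in>UNIV. \<Sum>j\<in>UNIV. B i j l * v $ i * v $ j))"
  have lin: "linear D" using D by (rule has_derivative_linear)
  have chr: "christoffel G x k i j = (1/2) * (\<Sum>l\<in>UNIV. matrix_inv (G x) $ k $ l * B i j l)"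
    for k i j
    unfolding christoffel_def B_def by (simp add: partial_deriv_entry[OF D])
  have "w = - (matrix_inv (G x) *v b)"
  proof -
    have "(\<Sum>i\<in>UNIV. \<Sum>j\<in>UNIV. christoffel G x k i j * v $ i * v $ j)
        = (\<Sum>l\<in>UNIV. matrix_inv (G x) $ k $ l * b $ l)" for k
    proof -
      have "(\<Sum>i\<in>UNIV. \<Sum>j\<in>UNIV. christoffel G x k i j * v $ i * v $ j)
          = (\<Sum>i\<in>UNIV. \<Sum>j\<in>UNIV. \<Sum>l\<in>UNIV.
              matrix_inv (G x) $ k $ l * ((1/2) * (B i j l * v $ i * v $ j)))"
        unfolding chr by (simp add: sum_distrib_left sum_distrib_right mult_ac)
      also have "\<dots> = (\<Sum>i\<in>UNIV. \<Sum>l\<in>UNIV. \<Sum>j\<in>UNIV.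
              matrix_inv (G x) $ k $ l * ((1/2) * (B i j l * v $ i * v $ j)))"
        by (intro sum.cong refl sum.swap)
      also have "\<dots> = (\<Sum>l\<in>UNIV. \<Sum>i\<in>UNIV. \<Sum>j\<in>UNIV.
              matrix_inv (G x) $ k $ l * ((1/2) * (B i j l * v $ i * v $ j)))"
        by (rule sum.swap)
      also have "\<dots> = (\<Sum>l\<in>UNIV. matrix_inv (G x) $ k $ l * b $ l)"
        by (simp only: b_def vec_lambda_beta sum_distrib_left)
      finally show ?thesis .
    qed
    thus ?thesis by (simp add: w vec_eq_iff matrix_vector_mult_def)
  qed
  moreover have "G x ** matrix_inv (G x) = mat 1"
    using someI_ex[OF riemannian_metric_invertible[OF G, unfolded invertible_def]]
    unfolding matrix_inv_def by blast
  ultimately have Gw: "G x *v w = - b"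
    by (simp add: linear_neg matrix_vector_mul_assoc)
  have "2 * (b \<bullet> y) = (\<Sum>l\<in>UNIV. \<Sum>i\<in>UNIV. \<Sum>j\<in>UNIV. B i j l * v $ i * v $ j * y $ l)"
    by (simp add: b_def inner_vec_def sum_distrib_left sum_distrib_right mult_ac)
  also have "\<dots> = (\<Sum>l\<in>UNIV. \<Sum>i\<in>UNIV. \<Sum>j\<in>UNIV. D (axis i 1) $ j $ l * v $ i * v $ j * y $ l)
      + (\<Sum>l\<in>UNIV. \<Sum>i\<in>UNIV. \<Sum>j\<in>UNIV. D (axis j 1) $ i $ l * v $ i * v $ j * y $ l)
      - (\<Sum>l\<in>UNIV. \<Sum>i\<in>UNIV. \<Sum>j\<in>UNIV. D (axis l 1) $ i $ j * v $ i * v $ j * y $ l)"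
    (is "_ = ?P + ?Q - ?R")
    by (simp add: B_def sum.distrib sum_subtractf algebra_simps)
  also have "?P = ?Q"
    by (rule sum.cong[OF refl], subst sum.swap) (simp add: mult_ac)
  also have "?Q = (D v *v y) \<bullet> v"
  proof -
    have "?Q = (\<Sum>l\<in>UNIV. \<Sum>i\<in>UNIV. D v $ i $ l * v $ i * y $ l)"
      by (simp add: linear_sum_axis[OF lin, of v] sum_distrib_left sum_distrib_right mult_ac)
    also have "\<dots> = (D v *v y) \<bullet> v"
      unfolding bilinear_matrix_expand by (subst sum.swap) (simp add: mult_ac)
    finally show ?thesis .
  qed
  also have "?R = (D y *v v) \<bullet> v"
  proof -
    have "?R = (\<Sum>i\<in>UNIV. \<Sum>l\<in>UNIV. \<Sum>j\<in>UNIV. D (axis l 1) $ i $ j * v $ i * v $ j * y $ l)"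
      by (rule sum.swap)
    also have "\<dots> = (\<Sum>i\<in>UNIV. \<Sum>j\<in>UNIV. \<Sum>l\<in>UNIV. D (axis l 1) $ i $ j * v $ i * v $ j * y $ l)"
      by (intro sum.cong refl sum.swap)
    also have "\<dots> = (D y *v v) \<bullet> v"
      unfolding bilinear_matrix_expand
      by (simp add: linear_sum_axis[OF lin, of y] sum_distrib_left sum_distrib_right mult_ac)
    finally show ?thesis .
  qed
  finally have "2 * (b \<bullet> y) = 2 * ((D v *v y) \<bullet> v) - (D y *v v) \<bullet> v" by simp
  moreover have "(D v *v y) \<bullet> v = (D v *v v) \<bullet> y"
    using symmetric_matrix_inner[OF metric_derivative_symmetric[OF G D], of v v y]
    by (metis inner_commute symmetric_matrix_inner metric_derivative_symmetric[OF G D])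
  ultimately show ?thesis by (simp add: Gw)
qed

section \<open>The radial function outside the ball\<close>

text \<open>The point \<open>x\<close> may lie on the boundary sphere.  One of \<open>v\<close> and \<open>- v\<close> does not point
  into the ball, and along that ray \<open>F\<close> vanishes; linearity of \<open>F'\<close> does the rest.\<close>

lemma derivative_zero_on_exterior:
  fixes F :: "'a::euclidean_space \<Rightarrow> 'b::real_normed_vector"
  assumes F: "(F has_derivative F') (at x)"
    and zero: "\<And>y. norm y \<ge> r \<Longrightarrow> F y = 0" and "norm x \<ge> r"
  shows "F' v = 0"
proof -
  have lin: "linear F'" using F by (rule has_derivative_linear)
  have outward: "F' v = 0" if v: "x \<bullet> v \<ge> 0" for v
  proof -
    have "norm x \<le> norm (x + s *\<^sub>R v)" if "s \<ge> 0" for s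
    proof -
      have "(x + s *\<^sub>R v) \<bullet> (x + s *\<^sub>R v) = x \<bullet> x + 2 * (s * (x \<bullet> v)) + s\<^sup>2 * (v \<bullet> v)"
        by (simp add: inner_add_left inner_add_right inner_commute power2_eq_square algebra_simps)
      hence "x \<bullet> x \<le> (x + s *\<^sub>R v) \<bullet> (x + s *\<^sub>R v)" using that v by simp
      thus ?thesis by (simp add: norm_le)
    qed
    hence ray: "F (x + s *\<^sub>R v) = 0" if "s \<ge> 0" for s
      using that zero \<open>norm x \<ge> r\<close> by fastforce
    have "((\<lambda>s. x + s *\<^sub>R v) has_derivative (\<lambda>s. s *\<^sub>R v)) (at 0 within {0..})"
      by (auto intro!: derivative_eq_intros)
    from has_derivative_compose[OF this, of F F'] F
    have "((\<lambda>s. F (x + s *\<^sub>R v)) has_derivative (\<lambda>s. F' (s *\<^sub>R v))) (at 0 within {0..})"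
      by simp
    hence "((\<lambda>s. F (x + s *\<^sub>R v)) has_vector_derivative F' v) (at 0 within {0..})"
      using lin by (simp add: has_vector_derivative_def linear_scale)
    moreover have "((\<lambda>s. F (x + s *\<^sub>R v)) has_vector_derivative 0) (at 0 within {0..})"
      by (rule has_vector_derivative_transform[of 0 "{0..}" _ "\<lambda>_. 0"]) (auto simp: ray)
    ultimately show ?thesis
      by (rule vector_derivative_unique_within[rotated])
        (simp add: at_within_Ici_at_right)
  qed
  show ?thesis
  proof (cases "x \<bullet> v \<ge> 0")
    case False
    hence "F' (- v) = 0" by (intro outward) simp
    thus ?thesis using lin by (simp add: linear_neg)
  qed (rule outward)
qed

lemma has_derivative_matrix_vector_mult:
  fixes G :: "'a::real_normed_vector \<Rightarrow> real^'n^'m"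
  assumes "(G has_derivative D) (at x)" "(f has_derivative f') (at x)"
  shows "((\<lambda>y. G y *v f y) has_derivative (\<lambda>v. G x *v f' v + D v *v f x)) (at x)"
proof -
  have "bilinear (\<lambda>A :: real^'n^'m. (*v) A)"
    unfolding bilinear_def
    by (auto intro!: linearI simp: algebra_simps scaleR_matrix_vector_assoc)
  thus ?thesis
    using assms bilinear_conv_bounded_bilinear bounded_bilinear.FDERIV by blast
qed

text \<open>The function \<open>G(y) y - y\<close> vanishes outside the ball, hence so does its derivative; the
  second identity is the product rule, and the third is its case \<open>v = x\<close>,
  where \<open>G(x) x = x\<close>.\<close>

lemma exterior_metric_identities:
  assumes D: "(G has_derivative D) (at x)"
    and radial: "\<And>y. norm y \<ge> r\<^sub>c \<Longrightarrow> G y *v radial_vector y = radial_vector y"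
    and "r\<^sub>c > 0" and x: "norm x \<ge> r\<^sub>c"
  shows "G x *v x = x" and "D v *v x = v - G x *v v" and "D x *v x = 0"
proof -
  have fix_pos: "G y *v y = y" if "norm y \<ge> r\<^sub>c" for y
  proof -
    have "y \<noteq> 0" using that \<open>r\<^sub>c > 0\<close> by auto
    hence "y = norm y *\<^sub>R radial_vector y" by (simp add: radial_vector_def)
    thus ?thesis using radial[OF that] by (metis matrix_vector_mult_scaleR)
  qed
  have "((\<lambda>y. G y *v y - y) has_derivative (\<lambda>v. G x *v v + D v *v x - v)) (at x)"
    by (intro has_derivative_diff has_derivative_matrix_vector_mult D has_derivative_ident)
  hence "G x *v v + D v *v x - v = 0" for v
    by (rule derivative_zero_on_exterior) (use fix_pos x in auto)
  thus diff: "D v *v x = v - G x *v v" for v by (simp add: algebra_simps eq_diff_eq)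
  show "G x *v x = x" using fix_pos x by simp
  thus "D x *v x = 0" by (simp add: diff)
qed

text \<open>With \<open>w\<close> the acceleration of a geodesic through \<open>x\<close> with velocity \<open>v\<close>, the left-hand side
  is the second derivative of \<open>|\<gamma>|\<^sup>2 / 2\<close>.  Since \<open>G(x) x = x\<close>, the Euclidean product
  \<open>x \<bullet> w\<close> is a \<open>g\<close>-product, so the lowered Christoffel symbols apply; differentiating
  \<open>G(y) y = y\<close> in the direction \<open>v\<close> evaluates the remaining term.\<close>

lemma exterior_radial_acceleration:
  assumes G: "riemannian_metric G" and D: "(G has_derivative D) (at x)"
    and radial: "\<And>y. norm y \<ge> r\<^sub>c \<Longrightarrow> G y *v radial_vector y = radial_vector y"
    and rc: "r\<^sub>c > 0" and x: "norm x \<ge> r\<^sub>c"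
    and w: "w = (\<chi> k. - (\<Sum>i\<in>UNIV. \<Sum>j\<in>UNIV. christoffel G x k i j * v $ i * v $ j))"
  shows "v \<bullet> v + x \<bullet> w = g_inner G x v v + (1/2) * ((D x *v v) \<bullet> v)"
proof -
  note ids = exterior_metric_identities[OF D radial rc x]
  have "transpose (G x) = G x" using G by (simp add: riemannian_metric_def)
  hence "x \<bullet> w = (G x *v w) \<bullet> x"
    using ids(1) by (metis symmetric_matrix_inner inner_commute)
  also have "\<dots> = (1/2) * ((D x *v v) \<bullet> v) - (D v *v v) \<bullet> x"
    by (rule christoffel_lowered[OF G D w])
  also have "(D v *v v) \<bullet> x = v \<bullet> (D v *v x)"
    by (rule symmetric_matrix_inner[OF metric_derivative_symmetric[OF G D]])
  also have "\<dots> = v \<bullet> v - g_inner G x v v"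
    by (simp add: ids g_inner_def inner_diff_right inner_commute)
  finally show ?thesis by simp
qed

lemma radial_matrix_deriv_eq:
  fixes G :: "real^'n \<Rightarrow> real^'n^'n"
  assumes D: "(G has_derivative D) (at x)" and "x \<noteq> 0"
  shows "radial_matrix_deriv G x = D (radial_vector x)"
proof -
  define u where "u = radial_vector x"
  have x: "norm x *\<^sub>R u = x" using \<open>x \<noteq> 0\<close> by (simp add: u_def radial_vector_def)
  have lin: "linear D" using D by (rule has_derivative_linear)
  have "((\<lambda>s. s *\<^sub>R u) has_derivative (\<lambda>s. s *\<^sub>R u)) (at (norm x))"
    by (auto intro!: derivative_eq_intros)
  from has_derivative_compose[OF this, of G D] D x
  have "((\<lambda>s. G (s *\<^sub>R u)) has_derivative (\<lambda>s. D (s *\<^sub>R u))) (at (norm x))" by simp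
  hence "((\<lambda>s. G (s *\<^sub>R u) $ i $ j) has_derivative (\<lambda>s. D (s *\<^sub>R u) $ i $ j)) (at (norm x))"
    for i j
    by (intro bounded_linear.has_derivative[OF bounded_linear_vec_nth])
  hence "((\<lambda>s. G (s *\<^sub>R u) $ i $ j) has_real_derivative D u $ i $ j) (at (norm x))" for i j
    using lin by (simp add: has_field_derivative_def linear_scale mult_commute_abs)
  hence "deriv (\<lambda>s. G (s *\<^sub>R u) $ i $ j) (norm x) = D u $ i $ j" for i j
    by (rule DERIV_imp_deriv)
  thus ?thesis by (simp add: radial_matrix_deriv_def vec_eq_iff flip: u_def)
qed

text \<open>\<open>G(x)\<close> is symmetric and has the radial vector as an eigenvector, so the Euclidean
  decomposition into a radial and a tangential part is also \<open>g\<close>-orthogonal.\<close>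

lemma radial_splitting:
  assumes G: "riemannian_metric G" and "G x *v radial_vector x = radial_vector x" and "x \<noteq> 0"
  defines "c \<equiv> \<lambda>v. v \<bullet> radial_vector x"
  defines "X \<equiv> \<lambda>v. v - c v *\<^sub>R radial_vector x"
  shows "g_inner G x v v = g_inner G x (X v) (X v) + (c v)\<^sup>2"
    and "g_inner G x (X v) (X v) \<ge> 0"
proof -
  define u where "u = radial_vector x"
  have u: "u \<bullet> u = 1"
    using \<open>x \<noteq> 0\<close> by (simp add: u_def radial_vector_def flip: power2_norm_eq_inner)
  have Xu: "X v \<bullet> u = 0" by (simp add: X_def c_def u inner_diff_left flip: u_def)
  have v: "v = X v + c v *\<^sub>R u" by (simp add: X_def u_def)
  have Gu: "G x *v u = u" using assms(2) by (simp add: u_def)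
  have "transpose (G x) = G x" using G by (simp add: riemannian_metric_def)
  hence GXu: "(G x *v X v) \<bullet> u = 0" using Gu Xu by (simp add: symmetric_matrix_inner)
  have "g_inner G x (X v + c v *\<^sub>R u) (X v + c v *\<^sub>R u) = g_inner G x (X v) (X v) + (c v)\<^sup>2"
    by (simp add: g_inner_def matrix_vector_right_distrib matrix_vector_mult_scaleR Gu
        inner_add_left inner_add_right GXu Xu u inner_commute[of u "X v"] power2_eq_square)
  thus "g_inner G x v v = g_inner G x (X v) (X v) + (c v)\<^sup>2" using v by simp
  show "g_inner G x (X v) (X v) \<ge> 0"
    using G by (cases "X v = 0") (auto simp: riemannian_metric_def g_inner_def intro: less_imp_le)
qed

text \<open>Write \<open>v = X + c u\<close> with \<open>u\<close> the radial unit vector and \<open>X\<close> tangent to the sphere.  The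
  splitting is \<open>g\<close>-orthogonal and \<open>\<partial>G/\<partial>r\<close> annihilates \<open>u\<close>, so the left-hand side, which is
  the radial acceleration found above, is at least \<open>c\<^sup>2 + (1 + r a) |X|\<^sub>g\<^sup>2\<close>, while
  \<open>|v|\<^sub>g\<^sup>2 = c\<^sup>2 + |X|\<^sub>g\<^sup>2\<close>.\<close>

lemma escape_condition_convexity:
  assumes G: "riemannian_metric G" and D: "(G has_derivative D) (at x)"
    and radial: "\<And>y. norm y \<ge> r\<^sub>c \<Longrightarrow> G y *v radial_vector y = radial_vector y"
    and rc: "r\<^sub>c > 0" and x: "norm x \<ge> r\<^sub>c"
    and escape: "\<And>X. X \<in> sphere_tangent x \<Longrightarrow>
      (((1/2) *\<^sub>R radial_matrix_deriv G x) *v X) \<bullet> X \<ge> a * (g_norm G x X)\<^sup>2"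
  shows "g_inner G x v v + (1/2) * ((D x *v v) \<bullet> v) \<ge> min 1 (1 + norm x * a) * g_inner G x v v"
proof -
  define u c X where "u = radial_vector x" and "c = v \<bullet> u" and "X = v - c *\<^sub>R u"
  have "x \<noteq> 0" using rc x by auto
  have u: "u \<bullet> u = 1" "x = norm x *\<^sub>R u"
    using \<open>x \<noteq> 0\<close> by (auto simp: u_def radial_vector_def simp flip: power2_norm_eq_inner)
  have lin: "linear D" using D by (rule has_derivative_linear)
  have Xu: "X \<bullet> u = 0" by (simp add: X_def c_def u inner_diff_left)
  hence tangent: "X \<in> sphere_tangent x"
    using u(2) by (metis (mono_tags, lifting) inner_scaleR_right mem_Collect_eq mult_zero_right sphere_tangent_def)
  have v: "v = X + c *\<^sub>R u" by (simp add: X_def)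
  have g: "g_inner G x v v = g_inner G x X X + c\<^sup>2" and gX: "g_inner G x X X \<ge> 0"
    using radial_splitting[OF G radial[OF x] \<open>x \<noteq> 0\<close>, of v] by (auto simp: X_def c_def u_def)
  define M where "M = D u"
  have Dx: "D x = norm x *\<^sub>R M" unfolding M_def by (metis u(2) linear_scale[OF lin])
  have "norm x *\<^sub>R (norm x *\<^sub>R (M *v u)) = 0"
    using exterior_metric_identities(3)[OF D radial rc x] Dx u(2)
    by (metis matrix_vector_mult_scaleR scaleR_matrix_vector_assoc)
  hence Mu: "M *v u = 0" using \<open>x \<noteq> 0\<close> by simp
  have "transpose M = M" unfolding M_def by (rule metric_derivative_symmetric[OF G D])
  hence MXu: "(M *v X) \<bullet> u = 0" using Mu by (simp add: symmetric_matrix_inner)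
  have "(D x *v v) \<bullet> v = norm x * ((M *v X) \<bullet> X)"
    by (simp add: Dx v matrix_vector_right_distrib matrix_vector_mult_scaleR Mu
        inner_add_right MXu flip: scaleR_matrix_vector_assoc)
  moreover have "(1/2) * ((M *v X) \<bullet> X) \<ge> a * g_inner G x X X"
    using escape[OF tangent] radial_matrix_deriv_eq[OF D \<open>x \<noteq> 0\<close>] gX
    by (simp add: M_def u_def g_norm_def flip: scaleR_matrix_vector_assoc)
  ultimately have "(1/2) * ((D x *v v) \<bullet> v) \<ge> norm x * (a * g_inner G x X X)"
    by (metis mult.left_commute mult_left_mono norm_ge_zero)
  hence "g_inner G x v v + (1/2) * ((D x *v v) \<bullet> v) \<ge> 1 * c\<^sup>2 + (1 + norm x * a) * g_inner G x X X"
    by (simp add: g algebra_simps)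
  moreover have "min 1 (1 + norm x * a) * c\<^sup>2 \<le> 1 * c\<^sup>2"
    "min 1 (1 + norm x * a) * g_inner G x X X \<le> (1 + norm x * a) * g_inner G x X X"
    by (intro mult_right_mono; use gX in simp)+
  ultimately show "g_inner G x v v + (1/2) * ((D x *v v) \<bullet> v)
      \<ge> min 1 (1 + norm x * a) * g_inner G x v v"
    by (simp add: g distrib_left)
qed

text \<open>The hypothesis on \<open>\<alpha>\<close> says that \<open>1 + r \<alpha>\<close> is positive, and a positive continuous function
  has a positive minimum on the compact annulus.\<close>

lemma annulus_uniform_escape:
  fixes \<alpha> :: "real^'n \<Rightarrow> real"
  assumes "smooth_on {x. norm x \<ge> r\<^sub>c} \<alpha>"
    and gt: "\<And>x. norm x \<ge> r\<^sub>c \<Longrightarrow> \<alpha> x > - 1 / norm x" and "r\<^sub>c > 0"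
  shows "\<exists>\<delta>>0. \<forall>x. r\<^sub>c \<le> norm x \<and> norm x \<le> R \<longrightarrow> \<delta> \<le> min 1 (1 + norm x * \<alpha> x)"
proof -
  define A where "A = {x :: real^'n. r\<^sub>c \<le> norm x \<and> norm x \<le> R}"
  obtain U h where U: "{x. norm x \<ge> r\<^sub>c} \<subseteq> U" "\<forall>k. Ck_on k U h" "\<forall>x\<in>{x. norm x \<ge> r\<^sub>c}. h x = \<alpha> x"
    using assms(1) unfolding smooth_on_def by blast
  have "continuous_on U h" using U(2) by (metis Ck_on.simps(1))
  hence "continuous_on A h" by (rule continuous_on_subset) (use U(1) in \<open>auto simp: A_def\<close>)
  moreover have "h x = \<alpha> x" if "x \<in> A" for x using that U(3) by (auto simp: A_def)
  ultimately have "continuous_on A \<alpha>" by (metis (no_types, lifting) continuous_on_cong)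
  hence cont: "continuous_on A (\<lambda>x. min 1 (1 + norm x * \<alpha> x))"
    by (intro continuous_intros)
  have "A = cball 0 R - ball 0 r\<^sub>c" by (auto simp: A_def)
  hence compact: "compact A" by (simp add: compact_diff)
  have pos: "min 1 (1 + norm x * \<alpha> x) > 0" if "x \<in> A" for x
  proof -
    have "norm x > 0" "\<alpha> x > - 1 / norm x" using gt[of x] that \<open>r\<^sub>c > 0\<close> by (auto simp: A_def)
    hence "\<alpha> x * norm x > - 1" by (subst (asm) pos_divide_less_eq) auto
    thus ?thesis by (simp add: mult.commute)
  qed
  show ?thesis
  proof (cases "A = {}")
    case True
    thus ?thesis by (intro exI[of _ 1]) (auto simp: A_def)
  next
    case False
    obtain y where "y \<in> A" "\<forall>x\<in>A. min 1 (1 + norm y * \<alpha> y) \<le> min 1 (1 + norm x * \<alpha> x)"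
      using continuous_attains_inf[OF compact False cont] by blast
    thus ?thesis using pos by (intro exI[of _ "min 1 (1 + norm y * \<alpha> y)"]) (auto simp: A_def)
  qed
qed

text \<open>The bounded quantity is the second derivative of \<open>|\<gamma>|\<^sup>2 / 2\<close> along the geodesic through \<open>x\<close>
  with velocity \<open>v\<close>.  That \<open>\<delta>\<close> is the same for all unit vectors \<open>v\<close> is what makes the hitting
  time independent of the direction of the geodesic.\<close>

lemma annulus_radial_convexity:
  assumes "exterior_escape_metric G r\<^sub>c"
  shows "\<exists>\<delta>>0. \<forall>x v. r\<^sub>c \<le> norm x \<and> norm x \<le> R \<and> g_norm G x v = 1 \<longrightarrow>
    \<delta> \<le> v \<bullet> v + x \<bullet> (\<chi> k. - (\<Sum>i\<in>UNIV. \<Sum>j\<in>UNIV. christoffel G x k i j * v $ i * v $ j))"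
proof -
  have G: "riemannian_metric G" and rc: "r\<^sub>c > 0"
    and radial: "\<And>y. norm y \<ge> r\<^sub>c \<Longrightarrow> G y *v radial_vector y = radial_vector y"
    using assms by (auto simp: exterior_escape_metric_def complete_riemannian_metric_def)
  obtain \<alpha> where \<alpha>: "smooth_on {x. norm x \<ge> r\<^sub>c} \<alpha>" "\<And>x. norm x \<ge> r\<^sub>c \<Longrightarrow> \<alpha> x > - 1 / norm x"
    and escape: "\<And>x X. norm x \<ge> r\<^sub>c \<Longrightarrow> X \<in> sphere_tangent x \<Longrightarrow>
      (((1/2) *\<^sub>R radial_matrix_deriv G x) *v X) \<bullet> X \<ge> \<alpha> x * (g_norm G x X)\<^sup>2"
    using assms unfolding exterior_escape_metric_def by blast
  obtain \<delta> where \<delta>: "\<delta> > 0"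
    "\<And>x. r\<^sub>c \<le> norm x \<Longrightarrow> norm x \<le> R \<Longrightarrow> \<delta> \<le> min 1 (1 + norm x * \<alpha> x)"
    using annulus_uniform_escape[OF \<alpha> rc, of R] by blast
  show ?thesis
  proof (intro exI[of _ \<delta>] conjI allI impI \<delta>(1))
    fix x v
    assume *: "r\<^sub>c \<le> norm x \<and> norm x \<le> R \<and> g_norm G x v = 1"
    note D = riemannian_metric_has_derivative[OF G, of x]
    have "g_inner G x v v = 1" using * by (simp add: g_norm_def)
    hence "min 1 (1 + norm x * \<alpha> x) \<le> g_inner G x v v + (1/2) * ((frechet_derivative G (at x) x *v v) \<bullet> v)"
      using escape_condition_convexity[OF G D radial rc _ escape, of v] * by simp
    thus "\<delta> \<le> v \<bullet> v + x \<bullet> (\<chi> k. - (\<Sum>i\<in>UNIV. \<Sum>j\<in>UNIV. christoffel G x k i j * v $ i * v $ j))"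
      using exterior_radial_acceleration[OF G D radial rc _ refl, of v] \<delta>(2)[of x] *
      by linarith
  qed
qed

section \<open>Escape of geodesics\<close>

theorem theorem1p3:
  fixes G :: "real^'n \<Rightarrow> real^'n^'n" and r\<^sub>c :: real
  assumes "CARD('n) \<ge> 2"
    and "exterior_escape_metric G r\<^sub>c"
  shows "(\<forall>x \<gamma>. norm x = r\<^sub>c \<and> unit_speed_geodesic_from G x \<gamma> \<and>
            g_inner G x (velocity {0..} \<gamma> 0) (radial_vector x) \<ge> 0 \<longrightarrow>
            filterlim (\<lambda>t. norm (\<gamma> t)) at_top at_top)
       \<and> (\<forall>x. norm x > r\<^sub>c \<longrightarrow>
            (\<exists>c>0. \<forall>\<gamma>. unit_speed_geodesic_from G x \<gamma> \<longrightarrow>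
               filterlim (\<lambda>t. norm (\<gamma> t)) at_top at_top \<or>
               (\<exists>t\<^sub>0. 0 < t\<^sub>0 \<and> t\<^sub>0 \<le> c \<and> norm (\<gamma> t\<^sub>0) = r\<^sub>c)))"
proof -
  note metric = assms(2)
  have G: "riemannian_metric G" and rc: "r\<^sub>c > 0"
    and radial: "\<And>y. norm y \<ge> r\<^sub>c \<Longrightarrow> G y *v radial_vector y = radial_vector y"
    using metric by (auto simp: exterior_escape_metric_def complete_riemannian_metric_def)
  \<comment> \<open>\<open>h'\<close> and \<open>h''\<close> are the derivatives of \<open>h = |\<gamma>|\<^sup>2 / 2\<close>, the second with the acceleration
    replaced by its value from the geodesic equation.\<close>
  define V where "V = (velocity {0..} :: (real \<Rightarrow> real^'n) \<Rightarrow> _)"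
  define h where "h = (\<lambda>(\<gamma> :: real \<Rightarrow> real^'n) t. (1/2) * (\<gamma> t \<bullet> \<gamma> t))"
  define h' where "h' = (\<lambda>(\<gamma> :: real \<Rightarrow> real^'n) t. \<gamma> t \<bullet> V \<gamma> t)"
  define h'' where "h'' = (\<lambda>(\<gamma> :: real \<Rightarrow> real^'n) t. V \<gamma> t \<bullet> V \<gamma> t + \<gamma> t \<bullet>
    (\<chi> k. - (\<Sum>i\<in>UNIV. \<Sum>j\<in>UNIV. christoffel G (\<gamma> t) k i j * V \<gamma> t $ i * V \<gamma> t $ j)))"
  have level: "(1/2) * a\<^sup>2 \<le> h \<gamma> t \<longleftrightarrow> a \<le> norm (\<gamma> t)" "h \<gamma> t \<le> (1/2) * a\<^sup>2 \<longleftrightarrow> norm (\<gamma> t) \<le> a"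
    if "a \<ge> 0" for a \<gamma> t
    using that by (simp_all add: h_def power_mono_iff flip: power2_norm_eq_inner)
  have d1: "(h \<gamma> has_real_derivative h' \<gamma> t) (at t within {0..})"
    and d2: "(h' \<gamma> has_real_derivative h'' \<gamma> t) (at t within {0..})"
    if "unit_speed_geodesic_from G x \<gamma>" "t \<ge> 0" for \<gamma> x t
  proof -
    have v: "(\<gamma> has_derivative (\<lambda>s. s *\<^sub>R V \<gamma> t)) (at t within {0..})"
      and w: "(V \<gamma> has_derivative (\<lambda>s. s *\<^sub>R
          (\<chi> k. - (\<Sum>i\<in>UNIV. \<Sum>j\<in>UNIV. christoffel G (\<gamma> t) k i j * V \<gamma> t $ i * V \<gamma> t $ j))))
        (at t within {0..})"
      using that unfolding unit_speed_geodesic_from_def geodesic_on_def V_def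
      by (auto simp: has_vector_derivative_def)
    show "(h \<gamma> has_real_derivative h' \<gamma> t) (at t within {0..})"
      unfolding h_def h'_def has_field_derivative_def
      by (rule derivative_eq_intros refl v)+ (simp add: fun_eq_iff inner_commute)
    show "(h' \<gamma> has_real_derivative h'' \<gamma> t) (at t within {0..})"
      unfolding h'_def h''_def has_field_derivative_def
      by (rule derivative_eq_intros refl v w)+ (simp add: fun_eq_iff algebra_simps)
  qed
  have convex: "\<exists>\<delta>>0. \<forall>\<gamma> x t. unit_speed_geodesic_from G x \<gamma> \<longrightarrow> t \<ge> 0 \<longrightarrow>
      r\<^sub>c \<le> norm (\<gamma> t) \<longrightarrow> norm (\<gamma> t) \<le> R \<longrightarrow> h'' \<gamma> t \<ge> \<delta>" for R
    using annulus_radial_convexity[OF metric, of R]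
    unfolding unit_speed_geodesic_from_def h''_def V_def by meson
  have escapes: "filterlim (\<lambda>t. norm (\<gamma> t)) at_top at_top"
    if \<gamma>: "unit_speed_geodesic_from G x \<gamma>" and T: "T \<ge> 0" "r\<^sub>c \<le> norm (\<gamma> T)" "h' \<gamma> T \<ge> 0"
    for \<gamma> x T
  proof -
    have "\<exists>\<delta>>0. \<forall>t\<ge>0. (1/2) * r\<^sub>c\<^sup>2 \<le> h \<gamma> t \<and> h \<gamma> t \<le> R \<longrightarrow> h'' \<gamma> t \<ge> \<delta>" for R
    proof -
      \<comment> \<open>The level \<open>h \<le> R\<close> corresponds to the radius \<open>sqrt (2 R)\<close>; the absolute value covers
        negative \<open>R\<close>.\<close>
      have "R \<le> (1/2) * (sqrt (2 * \<bar>R\<bar>))\<^sup>2" by simp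
      hence "norm (\<gamma> t) \<le> sqrt (2 * \<bar>R\<bar>)" if "h \<gamma> t \<le> R" for t
        using that level(2)[of "sqrt (2 * \<bar>R\<bar>)" \<gamma> t] by (simp del: real_sqrt_pow2_iff real_sqrt_pow2)
      thus ?thesis using convex[of "sqrt (2 * \<bar>R\<bar>)"] \<gamma> level(1) rc by (meson less_imp_le)
    qed
    hence "filterlim (h \<gamma>) at_top at_top"
      using T rc level(1)
      by (intro convex_above_level_escapes[OF d1[OF \<gamma>] d2[OF \<gamma>], of "(1/2) * r\<^sub>c\<^sup>2" T]) auto
    thus ?thesis
      unfolding filterlim_at_top
    proof (intro allI)
      fix Z
      assume "\<forall>Z. eventually (\<lambda>t. Z \<le> h \<gamma> t) at_top"
      hence "eventually (\<lambda>t. (1/2) * \<bar>Z\<bar>\<^sup>2 \<le> h \<gamma> t) at_top" by blast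
      thus "eventually (\<lambda>t. Z \<le> norm (\<gamma> t)) at_top"
        by eventually_elim (use level(1)[of "\<bar>Z\<bar>"] in fastforce)
    qed
  qed
  have initial: "h' \<gamma> 0 = norm x * g_inner G x (V \<gamma> 0) (radial_vector x)"
    "h' \<gamma> 0 \<ge> - norm x"
    if \<gamma>: "unit_speed_geodesic_from G x \<gamma>" and x: "norm x \<ge> r\<^sub>c" for \<gamma> x
  proof -
    have "x \<noteq> 0" using x rc by auto
    have \<gamma>0: "\<gamma> 0 = x" and "g_norm G x (V \<gamma> 0) = 1"
      using \<gamma> by (auto simp: unit_speed_geodesic_from_def V_def)
    hence unit: "g_inner G x (V \<gamma> 0) (V \<gamma> 0) = 1" by (simp add: g_norm_def)
    have "x = norm x *\<^sub>R radial_vector x" using \<open>x \<noteq> 0\<close> by (simp add: radial_vector_def)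
    hence h'0: "h' \<gamma> 0 = norm x * (V \<gamma> 0 \<bullet> radial_vector x)"
      unfolding h'_def \<gamma>0 by (metis inner_commute inner_scaleR_right)
    moreover have "g_inner G x (V \<gamma> 0) (radial_vector x) = V \<gamma> 0 \<bullet> radial_vector x"
      using G radial[OF x]
      by (simp add: g_inner_def riemannian_metric_def symmetric_matrix_inner)
    ultimately show "h' \<gamma> 0 = norm x * g_inner G x (V \<gamma> 0) (radial_vector x)" by simp
    have "(V \<gamma> 0 \<bullet> radial_vector x)\<^sup>2 \<le> 1"
      using radial_splitting[OF G radial[OF x] \<open>x \<noteq> 0\<close>, of "V \<gamma> 0"] unit by linarith
    hence "V \<gamma> 0 \<bullet> radial_vector x \<ge> - 1" by (simp add: abs_square_le_1 abs_le_iff)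
    hence "norm x * (V \<gamma> 0 \<bullet> radial_vector x) \<ge> norm x * - 1"
      by (intro mult_left_mono) auto
    thus "h' \<gamma> 0 \<ge> - norm x" using h'0 by simp
  qed
  show ?thesis
  proof (intro conjI allI impI)
    fix x \<gamma>
    assume *: "norm x = r\<^sub>c \<and> unit_speed_geodesic_from G x \<gamma> \<and>
      g_inner G x (velocity {0..} \<gamma> 0) (radial_vector x) \<ge> 0"
    hence "\<gamma> 0 = x" by (simp add: unit_speed_geodesic_from_def)
    thus "filterlim (\<lambda>t. norm (\<gamma> t)) at_top at_top"
      using * initial(1)[of x \<gamma>] by (intro escapes[of x \<gamma> 0]) (auto simp: V_def)
  next
    fix x :: "real^'n"
    assume x: "norm x > r\<^sub>c"
    obtain \<delta> where \<delta>: "\<delta> > 0" "\<And>\<gamma> t. unit_speed_geodesic_from G x \<gamma> \<Longrightarrow> t \<ge> 0 \<Longrightarrow>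
        r\<^sub>c \<le> norm (\<gamma> t) \<Longrightarrow> norm (\<gamma> t) \<le> norm x \<Longrightarrow> h'' \<gamma> t \<ge> \<delta>"
      using convex[of "norm x"] by blast
    show "\<exists>c>0. \<forall>\<gamma>. unit_speed_geodesic_from G x \<gamma> \<longrightarrow>
        filterlim (\<lambda>t. norm (\<gamma> t)) at_top at_top \<or>
        (\<exists>t\<^sub>0. 0 < t\<^sub>0 \<and> t\<^sub>0 \<le> c \<and> norm (\<gamma> t\<^sub>0) = r\<^sub>c)"
    proof (intro exI[of _ "norm x / \<delta>"] conjI allI impI)
      show "norm x / \<delta> > 0" by (rule divide_pos_pos) (use x rc \<delta> in linarith)+
      fix \<gamma>
      assume \<gamma>: "unit_speed_geodesic_from G x \<gamma>"
      hence \<gamma>0: "\<gamma> 0 = x" by (simp add: unit_speed_geodesic_from_def)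
      show "filterlim (\<lambda>t. norm (\<gamma> t)) at_top at_top \<or>
        (\<exists>t\<^sub>0. 0 < t\<^sub>0 \<and> t\<^sub>0 \<le> norm x / \<delta> \<and> norm (\<gamma> t\<^sub>0) = r\<^sub>c)"
      proof (rule disjCI)
        assume no_hit: "\<not> (\<exists>t\<^sub>0. 0 < t\<^sub>0 \<and> t\<^sub>0 \<le> norm x / \<delta> \<and> norm (\<gamma> t\<^sub>0) = r\<^sub>c)"
        have "(\<gamma> has_vector_derivative V \<gamma> t) (at t within {0..})" if "t \<ge> 0" for t
          using \<gamma> that unfolding unit_speed_geodesic_from_def geodesic_on_def V_def by auto
        hence "continuous_on {0..} \<gamma>"
          by (auto intro: has_vector_derivative_continuous simp: continuous_on_eq_continuous_within)
        hence cont: "continuous_on {0..t} (\<lambda>s. norm (\<gamma> s))" for t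
          by (intro continuous_intros) (auto elim: continuous_on_subset)
        have outside: "r\<^sub>c \<le> norm (\<gamma> t)" if t: "0 \<le> t" "t \<le> norm x / \<delta>" for t
        proof (rule ccontr)
          assume "\<not> ?thesis"
          then obtain s where "0 \<le> s" "s \<le> t" "norm (\<gamma> s) = r\<^sub>c"
            using IVT2'[of "\<lambda>s. norm (\<gamma> s)" t r\<^sub>c 0] t x \<gamma>0 cont by force
          moreover from this have "s \<noteq> 0" using x \<gamma>0 by auto
          ultimately have "0 < s" "s \<le> norm x / \<delta>" "norm (\<gamma> s) = r\<^sub>c" using t by linarith+
          thus False using no_hit by blast
        qed
        have "\<exists>T. 0 \<le> T \<and> T \<le> norm x / \<delta> \<and> h' \<gamma> T \<ge> 0"
        proof (rule convex_above_level_turns[OF d1[OF \<gamma>] d2[OF \<gamma>]])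
          show "h'' \<gamma> t \<ge> \<delta>" if "t \<ge> 0" "(1/2) * r\<^sub>c\<^sup>2 \<le> h \<gamma> t" "h \<gamma> t \<le> h \<gamma> 0" for t
          proof (rule \<delta>(2)[OF \<gamma>])
            have "h \<gamma> 0 = (1/2) * (norm x)\<^sup>2" by (simp add: h_def \<gamma>0 power2_norm_eq_inner)
            thus "norm (\<gamma> t) \<le> norm x" using that level(2)[of "norm x" \<gamma> t] by simp
            show "r\<^sub>c \<le> norm (\<gamma> t)" using that level(1)[of "r\<^sub>c"] rc by simp
          qed (use that in auto)
          show "(1/2) * r\<^sub>c\<^sup>2 \<le> h \<gamma> t" if "0 \<le> t" "t \<le> norm x / \<delta>" for t
            using outside[OF that] level(1)[of "r\<^sub>c"] rc by simp
        qed (use \<delta> initial(2)[OF \<gamma>] x in auto)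
        thus "filterlim (\<lambda>t. norm (\<gamma> t)) at_top at_top"
          using escapes[OF \<gamma>] outside by blast
      qed
    qed
  qed
qed

end
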